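(* Let the network $(I,E)$ be a chain network (a directed path), with user groups, latencies and constraint function $h$ as in the context, and let $\boldsymbol\lambda=(\lambda_E,\lambda_R,\lambda_I)\in\mathbb{R}_{\ge 0}^3$. Suppose that: (1) $h$ is continuous and the set $\{(y,\tau)\in\mathcal{Y}_{\mathrm{adm}}\times\mathbb{R}^{|E|T}: h(y,\tau)\le 0\}$ is bounded; (2) for every $\tau\in\mathbb{R}_{\ge0}^{|E|T}$ and all $y,\bar y\in\mathcal{Y}_{\mathrm{adm}}$ such that, for all $e\in E,k\in[2],t\in[T]$, $\sum_{g\in G_e^E}y_{e,k,t}^g=\sum_{g\in G_e^E}\bar y_{e,k,t}^g$ and $y_{e,k,t}^{g'}=\bar y_{e,k,t}^{g'}$ for all $g'\in G_e^I$, one has $h(y,\tau)=h(\bar y,\tau)$; (3) for every $\tau\in\mathbb{R}_{\ge0}^{|E|T}$ and every $(\tau,\mathbf 0)$-DBCP equilibrium $y^\star$, for each $e\in E$, $t\in[T]$ with $\tau_{e,t}>0$, one has $y_{e,1,t}^{g\star}=0$ for each $g\in G_e^E$. If $\lambda_R\ge\lambda_E$, then $f_{D,\boldsymbol\lambda}^\star\le f_{C,\boldsymbol\lambda}^\star$.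
   Context: Network. $(I,E)$ is a chain network: a finite directed path, i.e. distinct nodes $i_0,\dots,i_m$ and edges $e_l$ from $i_{l-1}$ to $i_l$, $l=1,\dots,m$. $E_i^{\mathrm{in}},E_i^{\mathrm{out}}$ are the edges entering/leaving node $i$. Each edge has two lanes $k\in[2]=\{1,2\}$: an express lane ($k=1$, may be tolled) and a toll-free general-purpose lane ($k=2$). Both lanes of $e$ have the same latency function $\ell_e:\mathbb{R}\to\mathbb{R}$, strictly increasing, convex, nonnegative on $\mathbb{R}_{\ge0}$. Periods are $t\in[T]=\{1,\dots,T\}$. Users. $G=G^E\sqcup G^I$ is a finite set of groups, eligible ($G^E$) or ineligible ($G^I$). Group $g$ has an origin $p_o^g$ and destination $p_d^g$ joined by at least one directed route, a demand $d^g\ge0$, and values of time (VoT) $v_t^g>0$, $t\in[T]$. $G_e$ is the set of groups having a route from $p_o^g$ to $p_d^g$ containing $e$; $G_e^E=G_e\cap G^E$, $G_e^I=G_e\cap G^I$; $n=\sum_{e}|G_e|$. Flows. A flow is $y=(y_{e,k,t}^g: e\in E,k\in[2],t\in[T],g\in G_e)\in\mathbb{R}_{\ge0}^{2nT}$; $\mathcal{Y}_{\mathrm{adm}}$ is the set of flows such that for all $i\in I,g\in G,t\in[T]$: $d^g\mathbf 1\{i=p_o^g\}+\sum_{e\in E_i^{\mathrm{in}}}\sum_{k}y_{e,k,t}^g=d^g\mathbf 1\{i=p_d^g\}+\sum_{e\in E_i^{\mathrm{out}}}\sum_{k}y_{e,k,t}^g$ (sums over edges with $g\in G_e$). Lane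 flows: $x_{e,k,t}=\sum_{g\in G_e}y_{e,k,t}^g$. DBCP (discount-based congestion pricing). A policy is $(\tau,\alpha)$ with tolls $\tau\in\mathbb{R}_{\ge0}^{|E|T}$ and discounts $\alpha\in[0,1]^{|E|T}$. The feasible set is $\mathcal{Y}_{\mathrm{adm}}$. The cost $c_{e,k,t}^g(y)$ is $v_t^g\ell_e(x_{e,1,t})+\tau_{e,t}$ if $k=1,g\in G^I$; $v_t^g\ell_e(x_{e,1,t})+(1-\alpha_{e,t})\tau_{e,t}$ if $k=1,g\in G^E$; $v_t^g\ell_e(x_{e,2,t})$ if $k=2$. CBCP (credit-based congestion pricing). A policy is $(\tau,B)$ with $\tau\in\mathbb{R}_{\ge0}^{|E|T}$ and budgets $B\in\mathbb{R}_{\ge0}^{|G^E|}$. The feasible set is $\{y\in\mathcal{Y}_{\mathrm{adm}}:\sum_{t}\sum_{e}y_{e,1,t}^g\tau_{e,t}\le B^g\ \forall g\in G^E\}$. The cost $c_{e,k,t}^g(y)$ is $v_t^g\ell_e(x_{e,1,t})+\tau_{e,t}$ if $k=1,g\in G^I$, and $v_t^g\ell_e(x_{e,k,t})$ otherwise. Equilibrium. For either kind of policy, $y^\star$ is an equilibrium if it is feasible and for each $g\in G$ and every feasible $y$: $\sum_{e,k,t}(y_{e,k,t}^g-y_{e,k,t}^{g\star})c_{e,k,t}^g(y^\star)\ge0$. Societal costs. $h:\mathcal{Y}_{\mathrm{adm}}\times\mathbb{R}^{|E|T}\to\mathbb{R}^{n_c}$ is a given constraint function (inequalities $h\le0$ are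 componentwise). $f_{C,\boldsymbol\lambda}(y,x,\tau)=\lambda_E\sum_{t,e,k}\sum_{g\in G_e^E}v_t^g\ell_e(x_{e,k,t})y_{e,k,t}^g-\lambda_R\sum_{t,e}\sum_{g\in G_e^I}\tau_{e,t}y_{e,1,t}^g+\lambda_I\sum_{t,e,k}\sum_{g\in G_e^I}(v_t^g\ell_e(x_{e,k,t})+\mathbf 1\{k=1\}\tau_{e,t})y_{e,k,t}^g$. $f_{D,\boldsymbol\lambda}(y,x,\tau,\alpha)=\lambda_E\sum_{t,e,k}\sum_{g\in G_e^E}(v_t^g\ell_e(x_{e,k,t})+\mathbf 1\{k=1\}(1-\alpha_{e,t})\tau_{e,t})y_{e,k,t}^g+\lambda_I\sum_{t,e,k}\sum_{g\in G_e^I}(v_t^g\ell_e(x_{e,k,t})+\mathbf 1\{k=1\}\tau_{e,t})y_{e,k,t}^g-\lambda_R\sum_{t,e}\big(\sum_{g\in G_e^E}(1-\alpha_{e,t})\tau_{e,t}y_{e,1,t}^g+\sum_{g\in G_e^I}\tau_{e,t}y_{e,1,t}^g\big)$. $f_{C,\boldsymbol\lambda}^\star$ is the infimum of $f_{C,\boldsymbol\lambda}(y,x,\tau)$ over all $(y,x,\tau,B)$ with $\tau\in\mathbb{R}_{\ge0}^{|E|T}$, $B\in\mathbb{R}_{\ge0}^{|G^E|}$, $y$ a $(\tau,B)$-CBCP equilibrium with lane flows $x$, and $h(y,\tau)\le0$. $f_{D,\boldsymbol\lambda}^\star$ is the infimum of $f_{D,\boldsymbol\lambda}(y,x,\tau,\alpha)$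 over all $(y,x,\tau,\alpha)$ with $\tau\in\mathbb{R}_{\ge0}^{|E|T}$, $\alpha\in[0,1]^{|E|T}$, $y$ a $(\tau,\alpha)$-DBCP equilibrium with lane flows $x$, and $h(y,\tau)\le0$. The infimum over the empty set is $+\infty$. *)

theory Defs
  imports "HOL-Analysis.Analysis" "Graph_Theory.Arc_Walk"
begin

text \<open>
  Edges, periods and groups are drawn from finite types \<open>'e\<close>, \<open>'t\<close>, \<open>'g\<close>. All of \<open>'t\<close> is used as the
  set of periods (so \<open>T = CARD('t)\<close>; the order of the periods plays no role), whereas the edges and
  the groups of a model are subsets of their types. The two lanes are the elements \<open>1\<close> and \<open>2\<close>
  of the numeral type \<open>2\<close>; lane \<open>1\<close> is the express lane.

  Flows, tolls and budgets indexed by a subset of such a type are represented as vectors that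
  vanish at the remaining indices. This embeds the coordinate spaces isometrically, so that the
  library topology and boundedness of finite cartesian products are the intended ones.
\<close>

record ('v, 'e, 't, 'g) lane_model =
  network :: "('v, 'e) pre_digraph"
  eligible :: "'g set"
  ineligible :: "'g set"
  origin :: "'g \<Rightarrow> 'v"
  destination :: "'g \<Rightarrow> 'v"
  demand :: "'g \<Rightarrow> real"
  vot :: "'t \<Rightarrow> 'g \<Rightarrow> real"
  latency :: "'e \<Rightarrow> real \<Rightarrow> real"

type_synonym ('e, 't, 'g) flow = "(real, 'e \<times> 2 \<times> 't \<times> 'g) vec"
type_synonym ('e, 't) edge_vec = "(real, 'e \<times> 't) vec"
type_synonym 'g budget = "(real, 'g) vec"

definition chain_network :: "('v, 'e) pre_digraph \<Rightarrow> bool" where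
  "chain_network N \<longleftrightarrow>
    (\<exists>(m::nat) i e. inj_on i {0..m} \<and> verts N = i ` {0..m} \<and> arcs N = e ` {1..m} \<and>
      (\<forall>l\<in>{1..m}. tail N (e l) = i (l - 1) \<and> head N (e l) = i l))"

abbreviation edges :: "('v, 'e, 't, 'g) lane_model \<Rightarrow> 'e set" where
  "edges M \<equiv> arcs (network M)"

definition groups :: "('v, 'e, 't, 'g) lane_model \<Rightarrow> 'g set" where
  "groups M = eligible M \<union> ineligible M"

definition route :: "('v, 'e, 't, 'g) lane_model \<Rightarrow> 'g \<Rightarrow> 'e list \<Rightarrow> bool" where
  "route M g p \<longleftrightarrow> pre_digraph.apath (network M) (origin M g) p (destination M g)"

definition groups_on :: "('v, 'e, 't, 'g) lane_model \<Rightarrow> 'e \<Rightarrow> 'g set" where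
  "groups_on M e = {g \<in> groups M. \<exists>p. route M g p \<and> e \<in> set p}"

definition valid_model :: "('v, 'e, 't, 'g) lane_model \<Rightarrow> bool" where
  "valid_model M \<longleftrightarrow>
    eligible M \<inter> ineligible M = {} \<and>
    (\<forall>g\<in>groups M. (\<exists>p. route M g p) \<and> 0 \<le> demand M g \<and> (\<forall>t. 0 < vot M t g)) \<and>
    (\<forall>e\<in>edges M. strict_mono (latency M e) \<and> convex_on UNIV (latency M e) \<and>
      (\<forall>z\<ge>0. 0 \<le> latency M e z))"

definition flows :: "('v, 'e::finite, 't::finite, 'g::finite) lane_model \<Rightarrow> ('e, 't, 'g) flow set" where
  "flows M = {y. \<forall>e k t g. 0 \<le> y $ (e, k, t, g) \<and> (g \<notin> groups_on M e \<longrightarrow> y $ (e, k, t, g) = 0)}"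

definition adm_flows :: "('v, 'e::finite, 't::finite, 'g::finite) lane_model \<Rightarrow> ('e, 't, 'g) flow set" where
  "adm_flows M = {y \<in> flows M. \<forall>i\<in>verts (network M). \<forall>g\<in>groups M. \<forall>t.
     (if i = origin M g then demand M g else 0)
       + (\<Sum>e\<in>{e \<in> in_arcs (network M) i. g \<in> groups_on M e}. \<Sum>k\<in>UNIV. y $ (e, k, t, g))
     = (if i = destination M g then demand M g else 0)
       + (\<Sum>e\<in>{e \<in> out_arcs (network M) i. g \<in> groups_on M e}. \<Sum>k\<in>UNIV. y $ (e, k, t, g))}"

definition lane_flow ::
  "('v, 'e::finite, 't::finite, 'g::finite) lane_model \<Rightarrow> ('e, 't, 'g) flow \<Rightarrow> 'e \<Rightarrow> 2 \<Rightarrow> 't \<Rightarrow> real" where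
  "lane_flow M y e k t = (\<Sum>g\<in>groups_on M e. y $ (e, k, t, g))"

definition edge_vecs :: "('v, 'e::finite, 't::finite, 'g) lane_model \<Rightarrow> ('e, 't) edge_vec set" where
  "edge_vecs M = {\<tau>. \<forall>e t. e \<notin> edges M \<longrightarrow> \<tau> $ (e, t) = 0}"

definition tolls :: "('v, 'e::finite, 't::finite, 'g) lane_model \<Rightarrow> ('e, 't) edge_vec set" where
  "tolls M = {\<tau> \<in> edge_vecs M. \<forall>e\<in>edges M. \<forall>t. 0 \<le> \<tau> $ (e, t)}"

definition discounts :: "('v, 'e::finite, 't::finite, 'g) lane_model \<Rightarrow> ('e, 't) edge_vec set" where
  "discounts M = {\<alpha> \<in> edge_vecs M. \<forall>e\<in>edges M. \<forall>t. 0 \<le> \<alpha> $ (e, t) \<and> \<alpha> $ (e, t) \<le> 1}"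

definition budgets :: "('v, 'e, 't, 'g::finite) lane_model \<Rightarrow> 'g budget set" where
  "budgets M = {B. (\<forall>g\<in>eligible M. 0 \<le> B $ g) \<and> (\<forall>g. g \<notin> eligible M \<longrightarrow> B $ g = 0)}"

definition equilibrium ::
  "('v, 'e::finite, 't::finite, 'g::finite) lane_model \<Rightarrow> ('e, 't, 'g) flow set \<Rightarrow>
   (('e, 't, 'g) flow \<Rightarrow> 'g \<Rightarrow> 'e \<Rightarrow> 2 \<Rightarrow> 't \<Rightarrow> real) \<Rightarrow> ('e, 't, 'g) flow \<Rightarrow> bool" where
  "equilibrium M F c ys \<longleftrightarrow> ys \<in> F \<and>
    (\<forall>g\<in>groups M. \<forall>y\<in>F.
      0 \<le> (\<Sum>e\<in>{e \<in> edges M. g \<in> groups_on M e}. \<Sum>k\<in>UNIV. \<Sum>t\<in>UNIV.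
             (y $ (e, k, t, g) - ys $ (e, k, t, g)) * c ys g e k t))"

definition dbcp_cost ::
  "('v, 'e::finite, 't::finite, 'g::finite) lane_model \<Rightarrow> ('e, 't) edge_vec \<Rightarrow> ('e, 't) edge_vec \<Rightarrow>
   ('e, 't, 'g) flow \<Rightarrow> 'g \<Rightarrow> 'e \<Rightarrow> 2 \<Rightarrow> 't \<Rightarrow> real" where
  "dbcp_cost M \<tau> \<alpha> y g e k t =
    (if k = 1 then
       if g \<in> ineligible M then vot M t g * latency M e (lane_flow M y e 1 t) + \<tau> $ (e, t)
       else vot M t g * latency M e (lane_flow M y e 1 t) + (1 - \<alpha> $ (e, t)) * \<tau> $ (e, t)
     else vot M t g * latency M e (lane_flow M y e 2 t))"

definition dbcp_equilibrium ::
  "('v, 'e::finite, 't::finite, 'g::finite) lane_model \<Rightarrow> ('e, 't) edge_vec \<Rightarrow> ('e, 't) edge_vec \<Rightarrow>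
   ('e, 't, 'g) flow \<Rightarrow> bool" where
  "dbcp_equilibrium M \<tau> \<alpha> y \<longleftrightarrow> equilibrium M (adm_flows M) (dbcp_cost M \<tau> \<alpha>) y"

definition cbcp_flows ::
  "('v, 'e::finite, 't::finite, 'g::finite) lane_model \<Rightarrow> ('e, 't) edge_vec \<Rightarrow> 'g budget \<Rightarrow>
   ('e, 't, 'g) flow set" where
  "cbcp_flows M \<tau> B = {y \<in> adm_flows M. \<forall>g\<in>eligible M.
     (\<Sum>t\<in>UNIV. \<Sum>e\<in>{e \<in> edges M. g \<in> groups_on M e}. y $ (e, 1, t, g) * \<tau> $ (e, t)) \<le> B $ g}"

definition cbcp_cost ::
  "('v, 'e::finite, 't::finite, 'g::finite) lane_model \<Rightarrow> ('e, 't) edge_vec \<Rightarrow>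
   ('e, 't, 'g) flow \<Rightarrow> 'g \<Rightarrow> 'e \<Rightarrow> 2 \<Rightarrow> 't \<Rightarrow> real" where
  "cbcp_cost M \<tau> y g e k t =
    (if k = 1 \<and> g \<in> ineligible M
     then vot M t g * latency M e (lane_flow M y e 1 t) + \<tau> $ (e, t)
     else vot M t g * latency M e (lane_flow M y e k t))"

definition cbcp_equilibrium ::
  "('v, 'e::finite, 't::finite, 'g::finite) lane_model \<Rightarrow> ('e, 't) edge_vec \<Rightarrow> 'g budget \<Rightarrow>
   ('e, 't, 'g) flow \<Rightarrow> bool" where
  "cbcp_equilibrium M \<tau> B y \<longleftrightarrow> equilibrium M (cbcp_flows M \<tau> B) (cbcp_cost M \<tau>) y"

definition cbcp_societal ::
  "('v, 'e::finite, 't::finite, 'g::finite) lane_model \<Rightarrow> real \<Rightarrow> real \<Rightarrow> real \<Rightarrow>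
   ('e, 't, 'g) flow \<Rightarrow> ('e \<Rightarrow> 2 \<Rightarrow> 't \<Rightarrow> real) \<Rightarrow> ('e, 't) edge_vec \<Rightarrow> real" where
  "cbcp_societal M lamE lamR lamI y x \<tau> =
     lamE * (\<Sum>t\<in>UNIV. \<Sum>e\<in>edges M. \<Sum>k\<in>UNIV. \<Sum>g\<in>groups_on M e \<inter> eligible M.
       vot M t g * latency M e (x e k t) * y $ (e, k, t, g))
   - lamR * (\<Sum>t\<in>UNIV. \<Sum>e\<in>edges M. \<Sum>g\<in>groups_on M e \<inter> ineligible M.
       \<tau> $ (e, t) * y $ (e, 1, t, g))
   + lamI * (\<Sum>t\<in>UNIV. \<Sum>e\<in>edges M. \<Sum>k\<in>UNIV. \<Sum>g\<in>groups_on M e \<inter> ineligible M.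
       (vot M t g * latency M e (x e k t) + of_bool (k = 1) * \<tau> $ (e, t)) * y $ (e, k, t, g))"

definition dbcp_societal ::
  "('v, 'e::finite, 't::finite, 'g::finite) lane_model \<Rightarrow> real \<Rightarrow> real \<Rightarrow> real \<Rightarrow>
   ('e, 't, 'g) flow \<Rightarrow> ('e \<Rightarrow> 2 \<Rightarrow> 't \<Rightarrow> real) \<Rightarrow> ('e, 't) edge_vec \<Rightarrow> ('e, 't) edge_vec \<Rightarrow> real" where
  "dbcp_societal M lamE lamR lamI y x \<tau> \<alpha> =
     lamE * (\<Sum>t\<in>UNIV. \<Sum>e\<in>edges M. \<Sum>k\<in>UNIV. \<Sum>g\<in>groups_on M e \<inter> eligible M.
       (vot M t g * latency M e (x e k t) + of_bool (k = 1) * (1 - \<alpha> $ (e, t)) * \<tau> $ (e, t))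
         * y $ (e, k, t, g))
   + lamI * (\<Sum>t\<in>UNIV. \<Sum>e\<in>edges M. \<Sum>k\<in>UNIV. \<Sum>g\<in>groups_on M e \<inter> ineligible M.
       (vot M t g * latency M e (x e k t) + of_bool (k = 1) * \<tau> $ (e, t)) * y $ (e, k, t, g))
   - lamR * (\<Sum>t\<in>UNIV. \<Sum>e\<in>edges M.
       (\<Sum>g\<in>groups_on M e \<inter> eligible M. (1 - \<alpha> $ (e, t)) * \<tau> $ (e, t) * y $ (e, 1, t, g))
       + (\<Sum>g\<in>groups_on M e \<inter> ineligible M. \<tau> $ (e, t) * y $ (e, 1, t, g)))"

text \<open>The optimal values are extended reals; \<open>Inf {} = \<infinity>\<close> there.\<close>

definition cbcp_opt ::
  "('v, 'e::finite, 't::finite, 'g::finite) lane_model \<Rightarrow>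
   (('e, 't, 'g) flow \<times> ('e, 't) edge_vec \<Rightarrow> real ^ 'c) \<Rightarrow> real \<Rightarrow> real \<Rightarrow> real \<Rightarrow> ereal" where
  "cbcp_opt M h lamE lamR lamI =
     Inf {ereal (cbcp_societal M lamE lamR lamI y x \<tau>) | y x \<tau> B.
       \<tau> \<in> tolls M \<and> B \<in> budgets M \<and> cbcp_equilibrium M \<tau> B y \<and> x = lane_flow M y \<and> h (y, \<tau>) \<le> 0}"

definition dbcp_opt ::
  "('v, 'e::finite, 't::finite, 'g::finite) lane_model \<Rightarrow>
   (('e, 't, 'g) flow \<times> ('e, 't) edge_vec \<Rightarrow> real ^ 'c) \<Rightarrow> real \<Rightarrow> real \<Rightarrow> real \<Rightarrow> ereal" where
  "dbcp_opt M h lamE lamR lamI =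
     Inf {ereal (dbcp_societal M lamE lamR lamI y x \<tau> \<alpha>) | y x \<tau> \<alpha>.
       \<tau> \<in> tolls M \<and> \<alpha> \<in> discounts M \<and> dbcp_equilibrium M \<tau> \<alpha> y \<and> x = lane_flow M y \<and> h (y, \<tau>) \<le> 0}"

end

theory Submission
  imports Defs
begin

text \<open>
  On a chain network the flow conditions only say that, on every edge of its unique route, a group
  splits its demand between the two lanes, so equilibria decouple into one lane choice per edge,
  period and group. Given a CBCP equilibrium, keep all lane flows and the ineligible users, and
  reassign the express flow of the eligible users on each edge to those with the largest value of
  time. The marginal value of time times the time saving is a price at which this reassignment is
  optimal. The price lies in \<open>[0, \<tau>]\<close>, hence is realised by a discount: otherwise some eligible user
  would strictly gain from paying the full toll, and, time savings being decreasing in the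
  express flow, such a user would ride the express lane in an undiscounted equilibrium too.
  Finally, the variational inequality of the resulting DBCP equilibrium, tested against the CBCP
  flow with the same aggregates, shows that the eligible latency cost does not increase, and the
  tolls paid by eligible users enter with weight \<open>\<lambda>\<^sub>E - \<lambda>\<^sub>R \<le> 0\<close>.
\<close>

section \<open>Flow conservation on a directed path\<close>

text \<open>Here \<open>Y l\<close> stands for the flow on the edge entering node \<open>l\<close>,
  and \<open>b\<close>, \<open>c\<close> are the positions of origin and destination. The balance at
  \<open>b\<close> fixes the first edge, and each interior balance passes the value on to the next
  edge. If \<open>b = c\<close>, the two demand terms cancel and no edge is constrained.\<close>

lemma conservation_along_chain_iff:
  fixes Y :: "nat \<Rightarrow> real" and d :: real
  assumes "b \<le> c" and "c \<le> m"
  shows "(\<forall>j\<le>m. (if j = b then d else 0) + (if b < j \<and> j \<le> c then Y j else 0)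
           = (if j = c then d else 0) + (if b \<le> j \<and> j < c then Y (Suc j) else 0))
     \<longleftrightarrow> (\<forall>l. b < l \<and> l \<le> c \<longrightarrow> Y l = d)" (is "?L \<longleftrightarrow> ?R")
proof
  assume L: ?L
  have "b < l \<longrightarrow> l \<le> c \<longrightarrow> Y l = d" for l
  proof (induction l)
    case (Suc l)
    show ?case
    proof (intro impI)
      assume *: "b < Suc l" "Suc l \<le> c"
      show "Y (Suc l) = d"
        using L[rule_format, of l] Suc.IH * assms by (cases "l = b") auto
    qed
  qed simp
  then show ?R by blast
next
  assume ?R
  then show ?L using assms by auto
qed

lemma valid_route_exists: "valid_model M \<Longrightarrow> g \<in> groups M \<Longrightarrow> \<exists>p. route M g p"
  by (simp add: valid_model_def)

lemma in_groups_on_imp: "g \<in> groups_on M e \<Longrightarrow> g \<in> groups M \<and> e \<in> edges M"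
  by (auto simp: groups_on_def route_def pre_digraph.apath_def pre_digraph.awalk_def)

text \<open>The route of a group on a path is unique, so its whole demand has to cross every edge of
  that route. Node balances thereby turn into one separate equation per edge, period and group, and
  all later arguments use admissibility in this form.\<close>

lemma adm_flows_chain:
  fixes M :: "('v, 'e::finite, 't::finite, 'g::finite) lane_model"
  assumes chain: "chain_network (network M)" and valid: "valid_model M"
  shows "adm_flows M = {y \<in> flows M. \<forall>e\<in>edges M. \<forall>g\<in>groups_on M e. \<forall>t.
           y $ (e, 1, t, g) + y $ (e, 2, t, g) = demand M g}"
proof -
  define N where "N = network M"
  from chain obtain m :: nat and i a where "inj_on i {0..m} \<and> verts N = i ` {0..m} \<and> arcs N = a ` {1..m} \<and>
      (\<forall>l\<in>{1..m}. tail N (a l) = i (l - 1) \<and> head N (a l) = i l)"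
    unfolding chain_network_def N_def by (elim exE)
  then have i: "inj_on i {0..m}" "verts N = i ` {0..m}" and a: "arcs N = a ` {1..m}"
      "\<And>l. l \<in> {1..m} \<Longrightarrow> tail N (a l) = i (l - 1) \<and> head N (a l) = i l"
    by blast+
  have i_eq: "i j = i k \<longleftrightarrow> j = k" if "j \<le> m" "k \<le> m" for j k
    using i(1) that by (auto simp: inj_on_def)
  have a_eq: "a j = a k \<longleftrightarrow> j = k" if "j \<in> {1..m}" "k \<in> {1..m}" for j k
  proof -
    have "head N (a j) = i j" "head N (a k) = i k" using a(2) that by blast+
    moreover have "i j = i k \<longleftrightarrow> j = k" using i_eq that by simp
    ultimately show ?thesis by metis
  qed
  \<comment> \<open>Each arc raises the node index by exactly one, so a walk is determined by its
    two end indices and uses the consecutive block of arcs between them.\<close>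
  have walk: "\<exists>k\<ge>j. k \<le> m \<and> v = i k \<and> set p = a ` {j + 1..k}"
    if "j \<le> m" "set p \<subseteq> arcs N" "pre_digraph.cas N (i j) p v" for j p v
    using that
  proof (induction p arbitrary: j)
    case Nil
    then show ?case by (auto simp: pre_digraph.cas.simps)
  next
    case (Cons q p)
    then obtain l where l: "l \<in> {1..m}" "q = a l" using a by auto
    have "i (l - 1) = i j" using Cons.prems l a(2)[OF l(1)] by (simp add: pre_digraph.cas.simps)
    then have lj: "l = j + 1" using i_eq[of "l - 1" j] l(1) Cons.prems(1) by auto
    have "pre_digraph.cas N (i (j + 1)) p v"
      using Cons.prems l a(2)[OF l(1)] lj by (simp add: pre_digraph.cas.simps)
    from Cons.IH[OF _ _ this] obtain k where k: "k \<ge> j + 1" "k \<le> m" "v = i k" "set p = a ` {j + 1 + 1..k}"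
      using l lj Cons.prems by auto
    have "{j + 1..k} = insert (j + 1) {j + 1 + 1..k}" using k(1) by auto
    then show ?case using k l lj by (intro exI[of _ k]) auto
  qed
  \<comment> \<open>All routes of a group have the same arc set, so \<open>groups_on\<close> becomes
    an interval condition on arc indices.\<close>
  have span: "\<exists>b c. b \<le> c \<and> c \<le> m \<and> origin M g = i b \<and> destination M g = i c \<and>
      (\<forall>l\<in>{1..m}. g \<in> groups_on M (a l) \<longleftrightarrow> b < l \<and> l \<le> c)" if g: "g \<in> groups M" for g
  proof -
    obtain p where p: "route M g p" using valid_route_exists[OF valid g] by blast
    obtain b where b: "b \<le> m" "origin M g = i b"
      using p i(2) by (auto simp: route_def pre_digraph.apath_def pre_digraph.awalk_def N_def)
    have r: "\<exists>k\<ge>b. k \<le> m \<and> destination M g = i k \<and> set q = a ` {b + 1..k}" if "route M g q" for q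
      using that walk[OF b(1), of q] b(2)
      by (auto simp: route_def pre_digraph.apath_def pre_digraph.awalk_def N_def)
    obtain c where c: "b \<le> c" "c \<le> m" "destination M g = i c" "set p = a ` {b + 1..c}"
      using r[OF p] by blast
    have set_route: "set q = a ` {b + 1..c}" if "route M g q" for q
      using r[OF that] c i_eq by metis
    have "g \<in> groups_on M (a l) \<longleftrightarrow> b < l \<and> l \<le> c" if l: "l \<in> {1..m}" for l
    proof -
      have "g \<in> groups_on M (a l) \<longleftrightarrow> a l \<in> a ` {b + 1..c}"
        using set_route p g by (auto simp: groups_on_def)
      also have "\<dots> \<longleftrightarrow> b < l \<and> l \<le> c"
        using a_eq[OF l] c(2) by (auto simp: image_iff Bex_def)
      finally show ?thesis .
    qed
    then show ?thesis using b c by blast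
  qed
  have conservation: "(\<forall>x\<in>verts N. (if x = origin M g then demand M g else 0)
       + (\<Sum>e\<in>{e \<in> in_arcs N x. g \<in> groups_on M e}. \<Sum>k\<in>UNIV. y $ (e, k, t, g))
     = (if x = destination M g then demand M g else 0)
       + (\<Sum>e\<in>{e \<in> out_arcs N x. g \<in> groups_on M e}. \<Sum>k\<in>UNIV. y $ (e, k, t, g)))
    \<longleftrightarrow> (\<forall>e\<in>arcs N. g \<in> groups_on M e \<longrightarrow> y $ (e, 1, t, g) + y $ (e, 2, t, g) = demand M g)"
    (is "?L \<longleftrightarrow> ?R") if g: "g \<in> groups M" for g t and y :: "('e, 't, 'g) flow"
  proof -
    obtain b c where bc: "b \<le> c" "c \<le> m" "origin M g = i b" "destination M g = i c"
      and on: "\<And>l. l \<in> {1..m} \<Longrightarrow> g \<in> groups_on M (a l) \<longleftrightarrow> b < l \<and> l \<le> c"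
      using span[OF g] by blast
    define Y where "Y l = y $ (a l, 1, t, g) + y $ (a l, 2, t, g)" for l
    have ins: "{e \<in> in_arcs N (i j). g \<in> groups_on M e} = (if b < j \<and> j \<le> c then {a j} else {})"
      if "j \<le> m" for j
    proof -
      have "e \<in> {e \<in> in_arcs N (i j). g \<in> groups_on M e} \<longleftrightarrow> b < j \<and> j \<le> c \<and> e = a j" for e
        using a on i_eq that bc by (auto simp: in_arcs_def)
      then show ?thesis by auto
    qed
    have outs: "{e \<in> out_arcs N (i j). g \<in> groups_on M e} = (if b \<le> j \<and> j < c then {a (Suc j)} else {})"
      if "j \<le> m" for j
    proof -
      have "e \<in> {e \<in> out_arcs N (i j). g \<in> groups_on M e} \<longleftrightarrow> b \<le> j \<and> j < c \<and> e = a (Suc j)" for e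
      proof
        assume "e \<in> {e \<in> out_arcs N (i j). g \<in> groups_on M e}"
        then obtain l where l: "l \<in> {1..m}" "e = a l" "tail N (a l) = i j" "g \<in> groups_on M (a l)"
          using a by (auto simp: out_arcs_def)
        then have "l - 1 = j" using a(2)[OF l(1)] i_eq[of "l - 1" j] that by auto
        then show "b \<le> j \<and> j < c \<and> e = a (Suc j)" using l on[OF l(1)] by auto
      qed (use a on bc in \<open>auto simp: out_arcs_def\<close>)
      then show ?thesis by auto
    qed
    have verts: "(\<forall>x\<in>verts N. P x) \<longleftrightarrow> (\<forall>j\<le>m. P (i j))" for P
      unfolding i(2) by auto
    have node: "((if i j = origin M g then demand M g else 0)
       + (\<Sum>e\<in>{e \<in> in_arcs N (i j). g \<in> groups_on M e}. \<Sum>k\<in>UNIV. y $ (e, k, t, g))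
     = (if i j = destination M g then demand M g else 0)
       + (\<Sum>e\<in>{e \<in> out_arcs N (i j). g \<in> groups_on M e}. \<Sum>k\<in>UNIV. y $ (e, k, t, g)))
     \<longleftrightarrow> ((if j = b then demand M g else 0) + (if b < j \<and> j \<le> c then Y j else 0)
           = (if j = c then demand M g else 0) + (if b \<le> j \<and> j < c then Y (Suc j) else 0))"
      if "j \<le> m" for j
      unfolding ins[OF that] outs[OF that] bc(3,4)
      using that bc i_eq[of j b] i_eq[of j c] by (simp add: sum_2 Y_def)
    have "?L \<longleftrightarrow> (\<forall>j\<le>m. (if j = b then demand M g else 0) + (if b < j \<and> j \<le> c then Y j else 0)
           = (if j = c then demand M g else 0) + (if b \<le> j \<and> j < c then Y (Suc j) else 0))"
      unfolding verts by (simp only: node cong: imp_cong)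
    also have "\<dots> \<longleftrightarrow> (\<forall>l. b < l \<and> l \<le> c \<longrightarrow> Y l = demand M g)"
      using conservation_along_chain_iff bc by blast
    also have "\<dots> \<longleftrightarrow> ?R"
      using on bc(2) by (force simp: a(1) Y_def)
    finally show ?thesis .
  qed
  have "y \<in> adm_flows M \<longleftrightarrow> y \<in> flows M \<and> (\<forall>e\<in>edges M. \<forall>g\<in>groups_on M e. \<forall>t.
           y $ (e, 1, t, g) + y $ (e, 2, t, g) = demand M g)" for y :: "('e, 't, 'g) flow"
  proof -
    have swap: "(\<forall>i\<in>A. \<forall>g\<in>B. \<forall>t. P i g t) \<longleftrightarrow> (\<forall>g\<in>B. \<forall>t. \<forall>i\<in>A. P i g t)"
      for A :: "'v set" and B :: "'g set" and P :: "'v \<Rightarrow> 'g \<Rightarrow> 't \<Rightarrow> bool"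
      by blast
    have "y \<in> adm_flows M \<longleftrightarrow> y \<in> flows M \<and> (\<forall>g\<in>groups M. \<forall>t. \<forall>e\<in>edges M.
        g \<in> groups_on M e \<longrightarrow> y $ (e, 1, t, g) + y $ (e, 2, t, g) = demand M g)"
      unfolding adm_flows_def mem_Collect_eq swap
      by (simp only: conservation[unfolded N_def] cong: ball_cong)
    then show ?thesis by (auto dest: in_groups_on_imp)
  qed
  then show ?thesis by blast
qed

section \<open>Rationing a given capacity by willingness to pay\<close>

text \<open>Serve users in decreasing order of \<open>u\<close> until \<open>X\<close> is used up;
  \<open>p\<close> is the resulting cut-off price, with users at the cut-off served in part.
  Assumption \<open>lower\<close> says that everyone above \<open>p0\<close> fits into
  \<open>X\<close>, so the cut-off need not exceed \<open>p0\<close>; assumption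
  \<open>upper\<close> ensures that there is enough demand to fill \<open>X\<close>.\<close>

lemma threshold_allocation:
  fixes u d :: "'a \<Rightarrow> real" and X p0 :: real
  assumes fin: "finite S" and d: "\<And>g. g \<in> S \<Longrightarrow> 0 \<le> d g" and u: "\<And>g. g \<in> S \<Longrightarrow> 0 \<le> u g"
    and p0: "0 \<le> p0" and lower: "(\<Sum>g | g \<in> S \<and> p0 < u g. d g) \<le> X" and upper: "X \<le> sum d S"
  obtains p z where "0 \<le> p" "p \<le> p0" "\<And>g. g \<in> S \<Longrightarrow> 0 \<le> z g \<and> z g \<le> d g"
    "\<And>g. g \<in> S \<Longrightarrow> p < u g \<Longrightarrow> z g = d g" "\<And>g. g \<in> S \<Longrightarrow> u g < p \<Longrightarrow> z g = 0" "sum z S = X"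
proof -
  define U where "U p = (\<Sum>g | g \<in> S \<and> p < u g. d g)" for p
  \<comment> \<open>\<open>U\<close> changes only at values of \<open>u\<close>, so finitely many
    candidate prices suffice. The candidate \<open>p0\<close> makes the minimum below exist, by
    \<open>lower\<close>; the candidate 0 provides a predecessor for every positive
    \<open>p\<close>.\<close>
  define C where "C = {0, p0} \<union> {c \<in> u ` S. c \<le> p0}"
  define p where "p = Min {c \<in> C. U c \<le> X}"
  have finC: "finite C" and C: "\<And>c. c \<in> C \<Longrightarrow> 0 \<le> c \<and> c \<le> p0"
    using fin u p0 by (auto simp: C_def)
  have "p \<in> {c \<in> C. U c \<le> X}"
    unfolding p_def using finC lower by (intro Min_in) (auto simp: C_def U_def)
  then have p: "0 \<le> p" "p \<le> p0" "p \<in> C" "U p \<le> X" using C by auto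
  have below: "X < U c" if "c \<in> C" "c < p" for c
  proof (rule ccontr)
    assume "\<not> X < U c"
    then have "p \<le> c" unfolding p_def using finC that(1) by (intro Min_le) auto
    then show False using that(2) by simp
  qed
  define E where "E = (\<Sum>g | g \<in> S \<and> u g = p. d g)"
  have ge: "(\<Sum>g | g \<in> S \<and> p \<le> u g. d g) = U p + E"
    unfolding U_def E_def using fin
    by (subst sum.union_disjoint[symmetric]) (auto intro!: sum.cong)
  have "X \<le> (\<Sum>g | g \<in> S \<and> p \<le> u g. d g)"
  proof (cases "p = 0")
    case True
    then have "{g \<in> S. p \<le> u g} = S" using u by auto
    then show ?thesis using upper by simp
  next
    case False
    \<comment> \<open>\<open>c\<close> is the candidate just below \<open>p\<close>. No value of
      \<open>u\<close> lies strictly between them, so the users counted by \<open>U c\<close> all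
      have \<open>u\<close> at least \<open>p\<close>, while minimality of \<open>p\<close> gives
      \<open>X < U c\<close>.\<close>
    define c where "c = Max {c \<in> C. c < p}"
    have "c \<in> {c \<in> C. c < p}"
      unfolding c_def using finC False p by (intro Max_in) (auto simp: C_def)
    then have c: "c \<in> C" "c < p" by auto
    have gap: "p \<le> u g" if "g \<in> S" "c < u g" for g
    proof (rule ccontr)
      assume "\<not> p \<le> u g"
      then have "u g \<in> {c \<in> C. c < p}" using that p by (auto simp: C_def)
      then have "u g \<le> c" unfolding c_def using finC by (intro Max_ge) auto
      then show False using that by simp
    qed
    have "X \<le> U c" using below[OF c] by simp
    also have "\<dots> \<le> (\<Sum>g | g \<in> S \<and> p \<le> u g. d g)"
      unfolding U_def using fin gap d by (intro sum_mono2) auto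
    finally show ?thesis .
  qed
  then have XE: "X - U p \<le> E" using ge by simp
  have E0: "0 \<le> E" unfolding E_def using d by (intro sum_nonneg) auto
  \<comment> \<open>\<open>q\<close> is the common share served among the users exactly at the
    cut-off. If \<open>E = 0\<close>, then also \<open>X = U p\<close>, and the value 0 of the
    quotient 0/0 is the right one.\<close>
  define q where "q = (X - U p) / E"
  have q: "0 \<le> q" "q \<le> 1" "q * E = X - U p"
    using XE E0 p(4) by (auto simp: q_def divide_le_eq_1)
  define z where "z g = (if p < u g then d g else if u g = p then q * d g else 0)" for g
  have "sum z S = U p + q * E"
  proof -
    have "sum z S = (\<Sum>g\<in>S. (if p < u g then d g else 0) + (if u g = p then q * d g else 0))"
      by (intro sum.cong) (auto simp: z_def)
    also have "\<dots> = U p + q * E"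
      unfolding U_def E_def sum_distrib_left using fin by (simp add: sum.distrib sum.inter_filter)
    finally show ?thesis .
  qed
  then have "sum z S = X" using q by simp
  moreover have "0 \<le> z g \<and> z g \<le> d g" if "g \<in> S" for g
    using d[OF that] q mult_right_mono[of q 1 "d g"] by (auto simp: z_def)
  ultimately show thesis using that[of p z] p by (auto simp: z_def)
qed

section \<open>Lane choice edge by edge: equilibrium conditions and deviations\<close>

text \<open>Times a value of time, this is the group's willingness to pay for the express lane; it
  is negative when the express lane is slower.\<close>

definition time_saving ::
  "('v, 'e::finite, 't::finite, 'g::finite) lane_model \<Rightarrow> ('e, 't, 'g) flow \<Rightarrow> 'e \<Rightarrow> 't \<Rightarrow> real" where
  "time_saving M y e t = latency M e (lane_flow M y e 2 t) - latency M e (lane_flow M y e 1 t)"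

lemma lane_cases: "(k :: 2) = 1 \<or> k = 2"
  by (rule exhaust_2)

locale chain_model =
  fixes M :: "('v, 'e::finite, 't::finite, 'g::finite) lane_model"
  assumes chain: "chain_network (network M)" and valid: "valid_model M"
begin

lemma demand_nonneg: "g \<in> groups_on M e \<Longrightarrow> 0 \<le> demand M g"
  using valid by (auto simp: valid_model_def dest!: in_groups_on_imp)

lemma vot_pos: "g \<in> groups_on M e \<Longrightarrow> 0 < vot M t g"
  using valid by (auto simp: valid_model_def dest!: in_groups_on_imp)

lemma eligible_not_ineligible: "g \<in> eligible M \<Longrightarrow> g \<notin> ineligible M"
  using valid by (auto simp: valid_model_def)

lemma groups_on_cases: "g \<in> groups_on M e \<Longrightarrow> g \<in> eligible M \<or> g \<in> ineligible M"
  by (auto simp: groups_on_def groups_def)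

lemma latency_mono: "e \<in> edges M \<Longrightarrow> x \<le> y \<Longrightarrow> latency M e x \<le> latency M e y"
  using valid by (simp add: valid_model_def strict_mono_less_eq)

lemma latency_continuous: "e \<in> edges M \<Longrightarrow> continuous_on UNIV (latency M e)"
  using valid by (auto simp: valid_model_def intro: convex_on_continuous)

lemma adm_flowD:
  assumes "y \<in> adm_flows M"
  shows "0 \<le> y $ (e, k, t, g)"
    and "g \<notin> groups_on M e \<Longrightarrow> y $ (e, k, t, g) = 0"
    and "g \<in> groups_on M e \<Longrightarrow> y $ (e, 2, t, g) = demand M g - y $ (e, 1, t, g)"
    and "g \<in> groups_on M e \<Longrightarrow> y $ (e, 1, t, g) \<le> demand M g"
proof -
  have y: "\<And>e k t g. 0 \<le> y $ (e, k, t, g)" "\<And>e k t g. g \<notin> groups_on M e \<Longrightarrow> y $ (e, k, t, g) = 0"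
    using assms by (auto simp: adm_flows_chain[OF chain valid] flows_def)
  have *: "y $ (e, 1, t, g) + y $ (e, 2, t, g) = demand M g" if "g \<in> groups_on M e" for e t g
    using assms in_groups_on_imp[OF that] that by (simp add: adm_flows_chain[OF chain valid])
  show "0 \<le> y $ (e, k, t, g)" "g \<notin> groups_on M e \<Longrightarrow> y $ (e, k, t, g) = 0"
    using y by auto
  show "y $ (e, 2, t, g) = demand M g - y $ (e, 1, t, g)" if "g \<in> groups_on M e"
    using *[OF that, of t] by simp
  show "y $ (e, 1, t, g) \<le> demand M g" if "g \<in> groups_on M e"
    using *[OF that, of t] y(1)[of e 2 t g] by simp
qed

lemma adm_flowI:
  assumes "\<And>e k t g. 0 \<le> y $ (e, k, t, g)"
    and "\<And>e k t g. g \<notin> groups_on M e \<Longrightarrow> y $ (e, k, t, g) = 0"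
    and "\<And>e t g. g \<in> groups_on M e \<Longrightarrow> y $ (e, 1, t, g) + y $ (e, 2, t, g) = demand M g"
  shows "y \<in> adm_flows M"
  using assms by (simp add: adm_flows_chain[OF chain valid] flows_def)

lemma lane_flow_2:
  assumes "y \<in> adm_flows M"
  shows "lane_flow M y e 2 t = (\<Sum>g\<in>groups_on M e. demand M g) - lane_flow M y e 1 t"
  unfolding lane_flow_def sum_subtractf[symmetric]
  using adm_flowD(3)[OF assms] by (intro sum.cong) auto

text \<open>The total flow on an edge is fixed by the demands, so extra express flow slows the
  express lane and relieves the other one.\<close>

lemma time_saving_antimono:
  assumes "y \<in> adm_flows M" "y' \<in> adm_flows M" "e \<in> edges M"
    and "lane_flow M y e 1 t \<le> lane_flow M y' e 1 t"
  shows "time_saving M y' e t \<le> time_saving M y e t"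
  unfolding time_saving_def
  using assms by (intro diff_mono latency_mono) (auto simp: lane_flow_2)

text \<open>As the two lane flows of a group sum to its demand, a deviation on one edge in one
  period is a single number, multiplied in the variational inequality by price minus willingness to
  pay. \<open>full\<close> and \<open>empty\<close> make each such product nonnegative; at equality
  any split will do.\<close>

lemma dbcp_equilibriumI:
  assumes y: "y \<in> adm_flows M"
    and full: "\<And>e g t. g \<in> groups_on M e \<Longrightarrow>
      (if g \<in> ineligible M then \<tau> $ (e, t) else (1 - \<alpha> $ (e, t)) * \<tau> $ (e, t)) < vot M t g * time_saving M y e t
      \<Longrightarrow> y $ (e, 1, t, g) = demand M g"
    and empty: "\<And>e g t. g \<in> groups_on M e \<Longrightarrow>
      vot M t g * time_saving M y e t < (if g \<in> ineligible M then \<tau> $ (e, t) else (1 - \<alpha> $ (e, t)) * \<tau> $ (e, t))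
      \<Longrightarrow> y $ (e, 1, t, g) = 0"
  shows "dbcp_equilibrium M \<tau> \<alpha> y"
  unfolding dbcp_equilibrium_def equilibrium_def
proof (intro conjI ballI y)
  fix g y' assume y': "y' \<in> adm_flows M"
  let ?c = "dbcp_cost M \<tau> \<alpha> y"
  have "0 \<le> (y' $ (e, 1, t, g) - y $ (e, 1, t, g)) * ?c g e 1 t
           + (y' $ (e, 2, t, g) - y $ (e, 2, t, g)) * ?c g e 2 t" if g: "g \<in> groups_on M e" for e t
  proof -
    define p where "p = (if g \<in> ineligible M then \<tau> $ (e, t) else (1 - \<alpha> $ (e, t)) * \<tau> $ (e, t))"
    have "y' $ (e, 2, t, g) - y $ (e, 2, t, g) = - (y' $ (e, 1, t, g) - y $ (e, 1, t, g))"
      using adm_flowD(3)[OF y g, of t] adm_flowD(3)[OF y' g, of t] by simp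
    moreover have "?c g e 1 t - ?c g e 2 t = p - vot M t g * time_saving M y e t"
      by (simp add: dbcp_cost_def p_def time_saving_def algebra_simps)
    ultimately have "(y' $ (e, 1, t, g) - y $ (e, 1, t, g)) * ?c g e 1 t
           + (y' $ (e, 2, t, g) - y $ (e, 2, t, g)) * ?c g e 2 t
        = (y' $ (e, 1, t, g) - y $ (e, 1, t, g)) * (p - vot M t g * time_saving M y e t)"
      by (metis (no_types, lifting) add_uminus_conv_diff mult_minus_left right_diff_distrib)
    moreover have "0 \<le> \<dots>"
    proof (cases p "vot M t g * time_saving M y e t" rule: linorder_cases)
      case less
      then show ?thesis
        using full[OF g, of t] adm_flowD(4)[OF y' g, of t]
        by (intro mult_nonpos_nonpos) (auto simp: p_def)
    next
      case greater
      then show ?thesis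
        using empty[OF g, of t] adm_flowD(1)[OF y', of e 1 t g]
        by (intro mult_nonneg_nonneg) (auto simp: p_def)
    qed simp
    ultimately show ?thesis by simp
  qed
  then show "0 \<le> (\<Sum>e\<in>{e \<in> edges M. g \<in> groups_on M e}. \<Sum>k\<in>UNIV. \<Sum>t\<in>UNIV.
             (y' $ (e, k, t, g) - y $ (e, k, t, g)) * ?c g e k t)"
    unfolding sum_2 sum.distrib[symmetric] by (intro sum_nonneg) auto
qed

text \<open>A budget couples all edges and periods of an eligible group, so its inequality does not
  decouple. It can still be tested with a change of one lane choice that does not raise the toll
  bill, since such a change stays within the budget. Credits make the express price 0 for eligible
  users.\<close>

lemma cbcp_deviation:
  assumes eq: "cbcp_equilibrium M \<tau> B y"
    and g: "g \<in> groups_on M e" and z: "0 \<le> z" "z \<le> demand M g"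
    and budget: "g \<in> eligible M \<Longrightarrow> z * \<tau> $ (e, t) \<le> y $ (e, 1, t, g) * \<tau> $ (e, t)"
  shows "0 \<le> (z - y $ (e, 1, t, g))
    * ((if g \<in> ineligible M then \<tau> $ (e, t) else 0) - vot M t g * time_saving M y e t)"
proof -
  have e: "e \<in> edges M" and gM: "g \<in> groups M" using in_groups_on_imp[OF g] by auto
  have yF: "y \<in> cbcp_flows M \<tau> B" and y: "y \<in> adm_flows M"
    using eq by (auto simp: cbcp_equilibrium_def equilibrium_def cbcp_flows_def)
  define y' :: "('e, 't, 'g) flow" where "y' = (\<chi> q. if q = (e, 1, t, g) then z
      else if q = (e, 2, t, g) then demand M g - z else y $ q)"
  have "y' \<in> adm_flows M"
    using adm_flowD[OF y] g z by (intro adm_flowI) (auto simp: y'_def)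
  moreover have "(\<Sum>t\<in>UNIV. \<Sum>e\<in>{e \<in> edges M. g' \<in> groups_on M e}. y' $ (e, 1, t, g') * \<tau> $ (e, t)) \<le> B $ g'"
    if g': "g' \<in> eligible M" for g'
  proof -
    have "(\<Sum>t\<in>UNIV. \<Sum>e\<in>{e \<in> edges M. g' \<in> groups_on M e}. y' $ (e, 1, t, g') * \<tau> $ (e, t))
        \<le> (\<Sum>t\<in>UNIV. \<Sum>e\<in>{e \<in> edges M. g' \<in> groups_on M e}. y $ (e, 1, t, g') * \<tau> $ (e, t))"
      using budget g' by (intro sum_mono) (auto simp: y'_def)
    also have "\<dots> \<le> B $ g'" using yF g' by (simp add: cbcp_flows_def)
    finally show ?thesis .
  qed
  ultimately have "y' \<in> cbcp_flows M \<tau> B" by (simp add: cbcp_flows_def)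
  let ?c = "cbcp_cost M \<tau> y"
  define \<Delta> where "\<Delta> = (z - y $ (e, 1, t, g)) * (?c g e 1 t - ?c g e 2 t)"
  have "0 \<le> (\<Sum>e\<in>{e \<in> edges M. g \<in> groups_on M e}. \<Sum>k\<in>UNIV. \<Sum>t\<in>UNIV.
             (y' $ (e, k, t, g) - y $ (e, k, t, g)) * ?c g e k t)"
    using eq gM \<open>y' \<in> cbcp_flows M \<tau> B\<close> by (auto simp: cbcp_equilibrium_def equilibrium_def)
  \<comment> \<open>Only the pair of \<open>e\<close> and \<open>t\<close> contributes, and there
    the two lanes change by opposite amounts.\<close>
  also have "\<dots> = (\<Sum>e'\<in>{e \<in> edges M. g \<in> groups_on M e}. \<Sum>t'\<in>UNIV. if e' = e \<and> t' = t then \<Delta> else 0)"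
    unfolding sum_2 sum.distrib[symmetric]
    by (intro sum.cong) (auto simp: y'_def \<Delta>_def adm_flowD(3)[OF y g] algebra_simps)
  also have "\<dots> = (\<Sum>e'\<in>{e \<in> edges M. g \<in> groups_on M e}. if e' = e then \<Delta> else 0)"
    by (intro sum.cong) auto
  also have "\<dots> = \<Delta>" using e g by simp
  finally have "0 \<le> \<Delta>" .
  moreover have "?c g e 1 t - ?c g e 2 t
      = (if g \<in> ineligible M then \<tau> $ (e, t) else 0) - vot M t g * time_saving M y e t"
    by (simp add: cbcp_cost_def time_saving_def algebra_simps)
  ultimately show ?thesis by (simp add: \<Delta>_def)
qed

section \<open>Existence of an undiscounted equilibrium\<close>

text \<open>
  A fixed point of the clipped step that moves each group's express share by its net gain is
  complementary: a positive gain forces the upper bound, a negative gain forces \<open>0\<close>. Brouwer applies.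
\<close>

lemma undiscounted_equilibrium_exists:
  obtains y where "y \<in> adm_flows M" "dbcp_equilibrium M \<tau> 0 y"
    "\<And>e g t. g \<in> groups_on M e \<Longrightarrow> \<tau> $ (e, t) < vot M t g * time_saving M y e t
      \<Longrightarrow> y $ (e, 1, t, g) = demand M g"
    "\<And>e g t. g \<in> groups_on M e \<Longrightarrow> vot M t g * time_saving M y e t < \<tau> $ (e, t)
      \<Longrightarrow> y $ (e, 1, t, g) = 0"
proof -
  \<comment> \<open>The fixed point is sought among express flows only, the other lane being the
    remainder in \<open>Y\<close>. Setting \<open>dv\<close> to 0 where a group does not use an edge
    makes the box force zero flow there.\<close>
  define dv :: "real ^ ('e \<times> 't \<times> 'g)"
    where "dv = (\<chi> q. if snd (snd q) \<in> groups_on M (fst q) then demand M (snd (snd q)) else 0)"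
  define Y :: "real ^ ('e \<times> 't \<times> 'g) \<Rightarrow> ('e, 't, 'g) flow"
    where "Y z = (\<chi> q. let (e, k, t, g) = q in
      if k = 1 then z $ (e, t, g) else dv $ (e, t, g) - z $ (e, t, g))" for z
  \<comment> \<open>The value 0 off \<open>edges M\<close> keeps \<open>F\<close> continuous, as
    latencies are controlled only on edges of the model; it agrees with the box, since
    \<open>dv\<close> is 0 at those indices.\<close>
  define F :: "real ^ ('e \<times> 't \<times> 'g) \<Rightarrow> real ^ ('e \<times> 't \<times> 'g)"
    where "F z = (\<chi> q. if fst q \<in> edges M then
       max 0 (min (dv $ q) (z $ q + (vot M (fst (snd q)) (snd (snd q))
          * time_saving M (Y z) (fst q) (fst (snd q)) - \<tau> $ (fst q, fst (snd q))))) else 0)" for z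
  have dv: "0 \<le> dv $ q" for q using demand_nonneg by (auto simp: dv_def)
  have Y1: "Y z $ (e, 1, t, g) = z $ (e, t, g)" and Y2: "Y z $ (e, 2, t, g) = dv $ (e, t, g) - z $ (e, t, g)"
    for z e t g by (simp_all add: Y_def)
  have contY: "continuous_on UNIV (\<lambda>z. lane_flow M (Y z) e k t)" for e k t
    unfolding lane_flow_def using lane_cases[of k]
    by (elim disjE; simp only: Y1 Y2; intro continuous_intros)
  have contS: "continuous_on UNIV (\<lambda>z. time_saving M (Y z) e t)" if "e \<in> edges M" for e t
    unfolding time_saving_def
    using continuous_on_compose2[OF latency_continuous[OF that] contY] by (intro continuous_intros) auto
  have "continuous_on (cbox 0 dv) (\<lambda>z. F z $ q)" for q
    unfolding F_def using contS[of "fst q" "fst (snd q)", THEN continuous_on_subset, of "cbox 0 dv"]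
    by (cases "fst q \<in> edges M") (auto intro!: continuous_intros)
  then have contF: "continuous_on (cbox 0 dv) F"
    using continuous_on_vec_lambda[of "cbox 0 dv" "\<lambda>q z. F z $ q"] by simp
  have "0 \<in> cbox 0 dv" using dv by (simp add: mem_box_cart)
  moreover have "F \<in> cbox 0 dv \<rightarrow> cbox 0 dv" using dv by (auto simp: mem_box_cart F_def)
  ultimately obtain z where z: "z \<in> cbox 0 dv" "F z = z"
    using brouwer[OF compact_cbox convex_box(1) _ contF] by blast
  have zb: "0 \<le> z $ q" "z $ q \<le> dv $ q" for q using z(1) by (auto simp: mem_box_cart simp del: split_paired_All)
  have adm: "Y z \<in> adm_flows M"
  proof (rule adm_flowI)
    show "0 \<le> Y z $ (e, k, t, g)" for e k t g
      using lane_cases[of k] zb[of "(e, t, g)"] by (auto simp: Y1 Y2)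
    show "Y z $ (e, k, t, g) = 0" if "g \<notin> groups_on M e" for e k t g
      using lane_cases[of k] zb[of "(e, t, g)"] that by (auto simp: Y1 Y2 dv_def)
  qed (simp add: Y1 Y2 dv_def)
  have fixpt: "z $ (e, t, g) = max 0 (min (demand M g)
      (z $ (e, t, g) + (vot M t g * time_saving M (Y z) e t - \<tau> $ (e, t))))"
    if "g \<in> groups_on M e" for e t g
    using arg_cong[OF z(2), of "\<lambda>z. z $ (e, t, g)"] in_groups_on_imp[OF that] that
    by (simp add: F_def dv_def)
  have full: "Y z $ (e, 1, t, g) = demand M g"
    if "g \<in> groups_on M e" "\<tau> $ (e, t) < vot M t g * time_saving M (Y z) e t" for e g t
    using fixpt[OF that(1), of t] that(2) demand_nonneg[OF that(1)] by (simp add: Y1 max_def min_def split: if_splits)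
  have empty: "Y z $ (e, 1, t, g) = 0"
    if "g \<in> groups_on M e" "vot M t g * time_saving M (Y z) e t < \<tau> $ (e, t)" for e g t
    using fixpt[OF that(1), of t] that(2) zb(2)[of "(e, t, g)"] that(1)
    by (simp add: Y1 dv_def max_def min_def split: if_splits)
  have "dbcp_equilibrium M \<tau> 0 (Y z)"
    using full empty by (intro dbcp_equilibriumI adm) (auto split: if_splits)
  then show thesis using that adm full empty by blast
qed

section \<open>A price between 0 and the toll at a CBCP equilibrium\<close>

text \<open>Compare \<open>y\<close> with an undiscounted equilibrium \<open>ys\<close>. Were the
  time saving larger in \<open>y\<close>, every ineligible user riding express in \<open>ys\<close>
  would gain strictly in \<open>y\<close> and ride there in full, while eligible users do not ride
  in \<open>ys\<close> at all. Then \<open>y\<close> would have at least as much express flow, and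
  so no larger saving.\<close>

lemma express_saturated:
  assumes no_eligible: "\<And>y g. dbcp_equilibrium M \<tau> 0 y \<Longrightarrow> g \<in> groups_on M e \<inter> eligible M
      \<Longrightarrow> y $ (e, 1, t, g) = 0"
    and y: "y \<in> adm_flows M"
    and full: "\<And>g. g \<in> groups_on M e \<inter> ineligible M \<Longrightarrow> \<tau> $ (e, t) < vot M t g * time_saving M y e t
      \<Longrightarrow> y $ (e, 1, t, g) = demand M g"
    and g: "g \<in> groups_on M e \<inter> eligible M" and gain: "\<tau> $ (e, t) < vot M t g * time_saving M y e t"
  shows "y $ (e, 1, t, g) = demand M g"
proof -
  obtain ys where ys: "ys \<in> adm_flows M" "dbcp_equilibrium M \<tau> 0 ys"
    and ys_full: "\<And>e g t. g \<in> groups_on M e \<Longrightarrow> \<tau> $ (e, t) < vot M t g * time_saving M ys e t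
      \<Longrightarrow> ys $ (e, 1, t, g) = demand M g"
    and ys_empty: "\<And>e g t. g \<in> groups_on M e \<Longrightarrow> vot M t g * time_saving M ys e t < \<tau> $ (e, t)
      \<Longrightarrow> ys $ (e, 1, t, g) = 0"
    using undiscounted_equilibrium_exists[of \<tau>] by blast
  have e: "e \<in> edges M" using g in_groups_on_imp[of g M e] by simp
  have "time_saving M y e t \<le> time_saving M ys e t"
  proof (rule ccontr)
    assume less: "\<not> time_saving M y e t \<le> time_saving M ys e t"
    have "ys $ (e, 1, t, g') \<le> y $ (e, 1, t, g')" if g': "g' \<in> groups_on M e" for g'
    proof (cases "g' \<in> eligible M \<or> vot M t g' * time_saving M ys e t < \<tau> $ (e, t)")
      case True
      then have "ys $ (e, 1, t, g') = 0" using no_eligible[OF ys(2), of g'] ys_empty g' by auto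
      then show ?thesis using adm_flowD(1)[OF y] by simp
    next
      case False
      moreover have "vot M t g' * time_saving M ys e t < vot M t g' * time_saving M y e t"
        using less vot_pos[OF g'] by simp
      ultimately have "y $ (e, 1, t, g') = demand M g'"
        using full[of g'] groups_on_cases[OF g'] g' by auto
      then show ?thesis using adm_flowD(4)[OF ys(1) g'] by simp
    qed
    then have "lane_flow M ys e 1 t \<le> lane_flow M y e 1 t"
      unfolding lane_flow_def by (rule sum_mono)
    then show False using time_saving_antimono[OF ys(1) y e] less by simp
  qed
  then have "vot M t g * time_saving M y e t \<le> vot M t g * time_saving M ys e t"
    using vot_pos[of g e t] g by (intro mult_left_mono) auto
  \<comment> \<open>In \<open>ys\<close> the group puts its full demand and also nothing on the
    express lane. Its demand is therefore 0, which settles the claim for \<open>y\<close>.\<close>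
  then have "ys $ (e, 1, t, g) = demand M g" using ys_full[of g e t] gain g by auto
  moreover have "ys $ (e, 1, t, g) = 0" using no_eligible[OF ys(2) g] .
  ultimately show ?thesis using adm_flowD(1,4)[OF y] g by (metis IntD1 antisym)
qed

text \<open>Ineligible users have no budget, so moving all or none of their demand to the express
  lane is always an allowed deviation.\<close>

lemma cbcp_ineligible:
  assumes eq: "cbcp_equilibrium M \<tau> B y" and g: "g \<in> groups_on M e" "g \<in> ineligible M"
  shows "\<tau> $ (e, t) < vot M t g * time_saving M y e t \<Longrightarrow> y $ (e, 1, t, g) = demand M g"
    and "vot M t g * time_saving M y e t < \<tau> $ (e, t) \<Longrightarrow> y $ (e, 1, t, g) = 0"
proof -
  have y: "y \<in> adm_flows M"
    using eq by (simp add: cbcp_equilibrium_def equilibrium_def cbcp_flows_def)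
  have dev: "0 \<le> (z - y $ (e, 1, t, g)) * (\<tau> $ (e, t) - vot M t g * time_saving M y e t)"
    if "0 \<le> z" "z \<le> demand M g" for z
    using cbcp_deviation[OF eq g(1) that, of t] g eligible_not_ineligible[of g] by auto
  show "y $ (e, 1, t, g) = demand M g" if "\<tau> $ (e, t) < vot M t g * time_saving M y e t"
    using dev[of "demand M g"] that adm_flowD(4)[OF y g(1), of t] demand_nonneg[OF g(1)]
    by (simp add: zero_le_mult_iff mult_le_0_iff)
  show "y $ (e, 1, t, g) = 0" if "vot M t g * time_saving M y e t < \<tau> $ (e, t)"
    using dev[of 0] that adm_flowD(1)[OF y, of e 1 t g] demand_nonneg[OF g(1)]
    by (simp add: zero_le_mult_iff mult_le_0_iff)
qed

text \<open>The eligible express flow of \<open>y\<close> is the capacity to be rationed. The price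
  stays below the toll because eligible users willing to pay more than the toll already ride in full
  in \<open>y\<close>.\<close>

lemma cbcp_aggregate_price:
  assumes no_eligible: "\<And>y e t g. dbcp_equilibrium M \<tau> 0 y \<Longrightarrow> 0 < \<tau> $ (e, t)
      \<Longrightarrow> g \<in> groups_on M e \<inter> eligible M \<Longrightarrow> y $ (e, 1, t, g) = 0"
    and \<tau>: "\<tau> \<in> tolls M" and eq: "cbcp_equilibrium M \<tau> B y" and e: "e \<in> edges M"
  obtains p z where "0 \<le> p" "p \<le> \<tau> $ (e, t)"
    "\<And>g. g \<in> groups_on M e \<inter> eligible M \<Longrightarrow> 0 \<le> z g \<and> z g \<le> demand M g"
    "\<And>g. g \<in> groups_on M e \<inter> eligible M \<Longrightarrow> p < vot M t g * time_saving M y e t \<Longrightarrow> z g = demand M g"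
    "\<And>g. g \<in> groups_on M e \<inter> eligible M \<Longrightarrow> vot M t g * time_saving M y e t < p \<Longrightarrow> z g = 0"
    "(\<Sum>g\<in>groups_on M e \<inter> eligible M. z g) = (\<Sum>g\<in>groups_on M e \<inter> eligible M. y $ (e, 1, t, g))"
proof -
  let ?S = "groups_on M e \<inter> eligible M"
  let ?w = "time_saving M y e t"
  have y: "y \<in> adm_flows M"
    using eq by (simp add: cbcp_equilibrium_def equilibrium_def cbcp_flows_def)
  have \<tau>0: "0 \<le> \<tau> $ (e, t)" using \<tau> e by (simp add: tolls_def)
  show thesis
  proof (cases "?w < 0")
    case True
    \<comment> \<open>With a slower express lane no eligible user rides: leaving it only lowers the
      toll bill. Price 0 and the zero allocation then work.\<close>
    have "y $ (e, 1, t, g) = 0" if g: "g \<in> ?S" for g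
    proof -
      have "0 \<le> - y $ (e, 1, t, g) * - (vot M t g * ?w)"
        using cbcp_deviation[OF eq, of g e 0 t] g demand_nonneg[of g e] adm_flowD(1)[OF y, of e 1 t g] \<tau>0
          eligible_not_ineligible[of g] by simp
      moreover have "vot M t g * ?w < 0" using True vot_pos[of g e t] g by (simp add: mult_pos_neg)
      ultimately show ?thesis using adm_flowD(1)[OF y, of e 1 t g]
        by (smt (verit) minus_mult_minus mult_pos_neg)
    qed
    moreover have "vot M t g * ?w < 0" if "g \<in> ?S" for g
      using True vot_pos[of g e t] that by (simp add: mult_pos_neg)
    ultimately show thesis
      using that[of 0 "\<lambda>_. 0"] \<tau>0 demand_nonneg by (force simp: sum.neutral)
  next
    case False
    have full: "y $ (e, 1, t, g) = demand M g" if g: "g \<in> ?S" and gain: "\<tau> $ (e, t) < vot M t g * ?w" for g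
    proof (cases "\<tau> $ (e, t) = 0")
      case True
      \<comment> \<open>\<open>no_eligible\<close> says nothing at a zero toll, but then riding
        consumes no budget and the deviation to full express use is feasible.\<close>
      have "0 \<le> (demand M g - y $ (e, 1, t, g)) * - (vot M t g * ?w)"
        using cbcp_deviation[OF eq, of g e "demand M g" t] g demand_nonneg[of g e] True
          eligible_not_ineligible[of g] by simp
      then show ?thesis using gain True adm_flowD(4)[OF y, of g e t] g
        by (smt (verit) mult_minus_right mult_pos_pos IntD1)
    next
      case False
      show ?thesis
      proof (rule express_saturated[OF _ y _ g gain])
        show "y $ (e, 1, t, g') = demand M g'"
          if "g' \<in> groups_on M e \<inter> ineligible M" "\<tau> $ (e, t) < vot M t g' * ?w" for g'
          using cbcp_ineligible(1)[OF eq] that by blast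
      qed (use no_eligible False \<tau>0 in auto)
    qed
    have "(\<Sum>g | g \<in> ?S \<and> \<tau> $ (e, t) < vot M t g * ?w. demand M g)
        = (\<Sum>g | g \<in> ?S \<and> \<tau> $ (e, t) < vot M t g * ?w. y $ (e, 1, t, g))"
      using full by (intro sum.cong) auto
    also have "\<dots> \<le> (\<Sum>g\<in>?S. y $ (e, 1, t, g))"
      using adm_flowD(1)[OF y] by (intro sum_mono2) auto
    finally have lower: "(\<Sum>g | g \<in> ?S \<and> \<tau> $ (e, t) < vot M t g * ?w. demand M g) \<le> (\<Sum>g\<in>?S. y $ (e, 1, t, g))" .
    have upper: "(\<Sum>g\<in>?S. y $ (e, 1, t, g)) \<le> sum (demand M) ?S"
      using adm_flowD(4)[OF y] by (intro sum_mono) auto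
    have "0 \<le> demand M g" "0 \<le> vot M t g * ?w" if "g \<in> ?S" for g
      using that demand_nonneg[of g e] vot_pos[of g e t] False by auto
    from threshold_allocation[OF _ this \<tau>0 lower upper] that show thesis by (metis finite)
  qed
qed

section \<open>From a CBCP to a DBCP equilibrium with the same lane flows\<close>

lemma lane_flow_eqI:
  assumes "\<And>e k t. (\<Sum>g\<in>groups_on M e \<inter> eligible M. y' $ (e, k, t, g))
       = (\<Sum>g\<in>groups_on M e \<inter> eligible M. y $ (e, k, t, g))"
    and "\<And>e k t g. g \<notin> eligible M \<Longrightarrow> y' $ (e, k, t, g) = y $ (e, k, t, g)"
  shows "lane_flow M y' = lane_flow M y"
proof -
  have "lane_flow M y' e k t = lane_flow M y e k t" for e k t
    unfolding lane_flow_def sum.Int_Diff[of "groups_on M e" _ "eligible M", OF finite] assms(1)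
    using assms(2) by simp
  then show ?thesis by (simp add: fun_eq_iff)
qed

lemma cbcp_equilibrium_to_dbcp:
  assumes no_eligible: "\<And>y e t g. dbcp_equilibrium M \<tau> 0 y \<Longrightarrow> 0 < \<tau> $ (e, t)
      \<Longrightarrow> g \<in> groups_on M e \<inter> eligible M \<Longrightarrow> y $ (e, 1, t, g) = 0"
    and \<tau>: "\<tau> \<in> tolls M" and eq: "cbcp_equilibrium M \<tau> B y"
  obtains y' \<alpha> where "\<alpha> \<in> discounts M" "dbcp_equilibrium M \<tau> \<alpha> y'"
    "\<And>e k t g. g \<notin> eligible M \<Longrightarrow> y' $ (e, k, t, g) = y $ (e, k, t, g)"
    "\<And>e k t. (\<Sum>g\<in>groups_on M e \<inter> eligible M. y' $ (e, k, t, g))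
       = (\<Sum>g\<in>groups_on M e \<inter> eligible M. y $ (e, k, t, g))"
proof -
  have y: "y \<in> adm_flows M"
    using eq by (simp add: cbcp_equilibrium_def equilibrium_def cbcp_flows_def)
  have "\<exists>p z. 0 \<le> p \<and> p \<le> \<tau> $ (e, t) \<and>
    (\<forall>g\<in>groups_on M e \<inter> eligible M. 0 \<le> z g \<and> z g \<le> demand M g
      \<and> (p < vot M t g * time_saving M y e t \<longrightarrow> z g = demand M g)
      \<and> (vot M t g * time_saving M y e t < p \<longrightarrow> z g = 0)) \<and>
    (\<Sum>g\<in>groups_on M e \<inter> eligible M. z g) = (\<Sum>g\<in>groups_on M e \<inter> eligible M. y $ (e, 1, t, g))"
    if "e \<in> edges M" for e t
    by (rule cbcp_aggregate_price[OF no_eligible \<tau> eq that, of t]) blast+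
  then obtain p z where pz: "\<And>e t. e \<in> edges M \<Longrightarrow> 0 \<le> p e t \<and> p e t \<le> \<tau> $ (e, t) \<and>
    (\<forall>g\<in>groups_on M e \<inter> eligible M. 0 \<le> z e t g \<and> z e t g \<le> demand M g
      \<and> (p e t < vot M t g * time_saving M y e t \<longrightarrow> z e t g = demand M g)
      \<and> (vot M t g * time_saving M y e t < p e t \<longrightarrow> z e t g = 0)) \<and>
    (\<Sum>g\<in>groups_on M e \<inter> eligible M. z e t g) = (\<Sum>g\<in>groups_on M e \<inter> eligible M. y $ (e, 1, t, g))"
    by metis
  \<comment> \<open>If the toll is \<open>0\<close>, then \<open>p = 0\<close> and \<open>p / \<tau> = 0\<close>: the discount is \<open>1\<close> and the price is still \<open>p\<close>.\<close>
  define \<alpha> :: "('e, 't) edge_vec"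
    where "\<alpha> = (\<chi> q. if fst q \<in> edges M then 1 - p (fst q) (snd q) / \<tau> $ q else 0)"
  define y' :: "('e, 't, 'g) flow" where "y' = (\<chi> q. let (e, k, t, g) = q in
     if g \<in> groups_on M e \<inter> eligible M then if k = 1 then z e t g else demand M g - z e t g else y $ q)"
  have y'_eligible: "y' $ (e, 1, t, g) = z e t g" "y' $ (e, 2, t, g) = demand M g - z e t g"
    if "g \<in> groups_on M e \<inter> eligible M" for e t g
    using that by (simp_all add: y'_def)
  have y'_other: "y' $ (e, k, t, g) = y $ (e, k, t, g)" if "g \<notin> groups_on M e \<inter> eligible M" for e k t g
    using that by (auto simp: y'_def)
  have adm: "y' \<in> adm_flows M"
  proof (rule adm_flowI)
    show "0 \<le> y' $ (e, k, t, g)" for e k t g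
    proof (cases "g \<in> groups_on M e \<inter> eligible M")
      case True
      then show ?thesis
        using pz[of e t] in_groups_on_imp[of g M e] lane_cases[of k] by (auto simp: y'_eligible)
    qed (simp add: y'_other adm_flowD(1)[OF y])
    show "y' $ (e, k, t, g) = 0" if "g \<notin> groups_on M e" for e k t g
      using that by (simp add: y'_other adm_flowD(2)[OF y])
    show "y' $ (e, 1, t, g) + y' $ (e, 2, t, g) = demand M g" if "g \<in> groups_on M e" for e t g
      using that by (cases "g \<in> eligible M") (simp_all add: y'_eligible y'_other adm_flowD(3)[OF y])
  qed
  have agg: "(\<Sum>g\<in>groups_on M e \<inter> eligible M. y' $ (e, k, t, g))
       = (\<Sum>g\<in>groups_on M e \<inter> eligible M. y $ (e, k, t, g))" for e k t
  proof (cases "e \<in> edges M")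
    case True
    then show ?thesis using lane_cases[of k] pz[OF True, of t]
      by (auto simp: y'_eligible adm_flowD(3)[OF y] sum_subtractf)
  next
    case False
    then have "groups_on M e = {}" by (auto dest: in_groups_on_imp)
    then show ?thesis by simp
  qed
  \<comment> \<open>Unchanged aggregates freeze the time savings, so optimality conditions derived
    at \<open>y\<close> are conditions at \<open>y'\<close>, for ineligible users as well.\<close>
  have same_saving: "time_saving M y' = time_saving M y"
    using lane_flow_eqI[of y' y] agg y'_other by (simp add: time_saving_def fun_eq_iff)
  have price: "(1 - \<alpha> $ (e, t)) * \<tau> $ (e, t) = p e t" if "e \<in> edges M" for e t
    using pz[OF that, of t] that by (auto simp: \<alpha>_def)
  have "0 \<le> p e t / \<tau> $ (e, t) \<and> p e t / \<tau> $ (e, t) \<le> 1" if "e \<in> edges M" for e t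
    using pz[OF that, of t] by (auto simp: divide_le_eq_1)
  then have "\<alpha> \<in> discounts M"
    by (simp add: discounts_def edge_vecs_def \<alpha>_def)
  moreover have "dbcp_equilibrium M \<tau> \<alpha> y'"
  proof (rule dbcp_equilibriumI[OF adm])
    fix e g t assume g: "g \<in> groups_on M e"
    then have e: "e \<in> edges M" by (auto dest: in_groups_on_imp)
    let ?p = "if g \<in> ineligible M then \<tau> $ (e, t) else (1 - \<alpha> $ (e, t)) * \<tau> $ (e, t)"
    show "y' $ (e, 1, t, g) = demand M g" if "?p < vot M t g * time_saving M y' e t"
      using that cbcp_ineligible(1)[OF eq g, of t] groups_on_cases[OF g] eligible_not_ineligible[of g] pz[OF e, of t] g
      by (cases "g \<in> eligible M") (auto simp: same_saving price[OF e] y'_eligible y'_other)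
    show "y' $ (e, 1, t, g) = 0" if "vot M t g * time_saving M y' e t < ?p"
      using that cbcp_ineligible(2)[OF eq g, of t] groups_on_cases[OF g] eligible_not_ineligible[of g] pz[OF e, of t] g
      by (cases "g \<in> eligible M") (auto simp: same_saving price[OF e] y'_eligible y'_other)
  qed
  ultimately show thesis using that agg y'_other by blast
qed

section \<open>Comparison of societal costs\<close>

text \<open>Sum the variational inequalities over the eligible groups and test with
  \<open>y\<close>. All of them pay the same discounted toll on a given edge and period, so with
  equal express aggregates the toll terms cancel and only latency costs remain.\<close>

lemma dbcp_latency_cost_le:
  assumes eq: "dbcp_equilibrium M \<tau> \<alpha> ys" and y: "y \<in> adm_flows M"
    and agg: "\<And>e t. (\<Sum>g\<in>groups_on M e \<inter> eligible M. y $ (e, 1, t, g))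
       = (\<Sum>g\<in>groups_on M e \<inter> eligible M. ys $ (e, 1, t, g))"
  shows "(\<Sum>t\<in>UNIV. \<Sum>e\<in>edges M. \<Sum>k\<in>UNIV. \<Sum>g\<in>groups_on M e \<inter> eligible M.
       vot M t g * latency M e (lane_flow M ys e k t) * ys $ (e, k, t, g))
    \<le> (\<Sum>t\<in>UNIV. \<Sum>e\<in>edges M. \<Sum>k\<in>UNIV. \<Sum>g\<in>groups_on M e \<inter> eligible M.
       vot M t g * latency M e (lane_flow M ys e k t) * y $ (e, k, t, g))"
proof -
  let ?d = "\<lambda>e k t g. y $ (e, k, t, g) - ys $ (e, k, t, g)"
  let ?vl = "\<lambda>e k t g. vot M t g * latency M e (lane_flow M ys e k t)"
  let ?c = "dbcp_cost M \<tau> \<alpha> ys"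
  have "0 \<le> (\<Sum>g\<in>eligible M. \<Sum>e\<in>{e \<in> edges M. g \<in> groups_on M e}. \<Sum>k\<in>UNIV. \<Sum>t\<in>UNIV. ?d e k t g * ?c g e k t)"
    using eq y by - (rule sum_nonneg, auto simp: dbcp_equilibrium_def equilibrium_def groups_def)
  also have "\<dots> = (\<Sum>e\<in>edges M. \<Sum>g\<in>{g \<in> eligible M. g \<in> groups_on M e}. \<Sum>k\<in>UNIV. \<Sum>t\<in>UNIV. ?d e k t g * ?c g e k t)"
    by (rule sum.swap_restrict) auto
  also have "\<dots> = (\<Sum>e\<in>edges M. \<Sum>t\<in>UNIV. \<Sum>k\<in>UNIV. \<Sum>g\<in>groups_on M e \<inter> eligible M. ?d e k t g * ?vl e k t g)"
  proof (rule sum.cong[OF refl])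
    fix e
    let ?S = "groups_on M e \<inter> eligible M"
    have "(\<Sum>g\<in>{g \<in> eligible M. g \<in> groups_on M e}. \<Sum>k\<in>UNIV. \<Sum>t\<in>UNIV. ?d e k t g * ?c g e k t)
        = (\<Sum>g\<in>?S. \<Sum>t\<in>UNIV. \<Sum>k\<in>UNIV. ?d e k t g * ?c g e k t)"
      by (intro sum.cong sum.swap) auto
    also have "\<dots> = (\<Sum>t\<in>UNIV. \<Sum>g\<in>?S. \<Sum>k\<in>UNIV. ?d e k t g * ?c g e k t)"
      by (rule sum.swap)
    also have "\<dots> = (\<Sum>t\<in>UNIV. \<Sum>k\<in>UNIV. \<Sum>g\<in>?S. ?d e k t g * ?c g e k t)"
      by (intro sum.cong sum.swap refl)
    also have "\<dots> = (\<Sum>t\<in>UNIV. \<Sum>k\<in>UNIV. \<Sum>g\<in>?S. ?d e k t g * ?vl e k t g)"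
    proof (rule sum.cong[OF refl])
      fix t
      have "(\<Sum>g\<in>?S. ?d e 1 t g * ?c g e 1 t)
          = (\<Sum>g\<in>?S. ?d e 1 t g * ?vl e 1 t g + ?d e 1 t g * ((1 - \<alpha> $ (e, t)) * \<tau> $ (e, t)))"
        by (intro sum.cong refl) (auto simp: dbcp_cost_def distrib_left dest: eligible_not_ineligible)
      also have "\<dots> = (\<Sum>g\<in>?S. ?d e 1 t g * ?vl e 1 t g)"
        unfolding sum.distrib sum_distrib_right[symmetric] sum_subtractf by (simp add: agg)
      finally show "(\<Sum>k\<in>UNIV. \<Sum>g\<in>?S. ?d e k t g * ?c g e k t)
          = (\<Sum>k\<in>UNIV. \<Sum>g\<in>?S. ?d e k t g * ?vl e k t g)"
        unfolding sum_2 by (simp add: dbcp_cost_def)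
    qed
    finally show "(\<Sum>g\<in>{g \<in> eligible M. g \<in> groups_on M e}. \<Sum>k\<in>UNIV. \<Sum>t\<in>UNIV. ?d e k t g * ?c g e k t)
        = (\<Sum>t\<in>UNIV. \<Sum>k\<in>UNIV. \<Sum>g\<in>?S. ?d e k t g * ?vl e k t g)" .
  qed
  also have "\<dots> = (\<Sum>t\<in>UNIV. \<Sum>e\<in>edges M. \<Sum>k\<in>UNIV. \<Sum>g\<in>groups_on M e \<inter> eligible M. ?d e k t g * ?vl e k t g)"
    by (rule sum.swap)
  finally show ?thesis by (simp add: algebra_simps sum_subtractf)
qed

lemma dbcp_societal_le_cbcp_societal:
  assumes lam: "0 \<le> lamE" "lamE \<le> lamR" and \<tau>: "\<tau> \<in> tolls M" and \<alpha>: "\<alpha> \<in> discounts M"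
    and eq: "dbcp_equilibrium M \<tau> \<alpha> y'" and y: "y \<in> adm_flows M"
    and other: "\<And>e k t g. g \<notin> eligible M \<Longrightarrow> y' $ (e, k, t, g) = y $ (e, k, t, g)"
    and agg: "\<And>e k t. (\<Sum>g\<in>groups_on M e \<inter> eligible M. y' $ (e, k, t, g))
       = (\<Sum>g\<in>groups_on M e \<inter> eligible M. y $ (e, k, t, g))"
  shows "dbcp_societal M lamE lamR lamI y' (lane_flow M y') \<tau> \<alpha>
    \<le> cbcp_societal M lamE lamR lamI y (lane_flow M y) \<tau>"
proof -
  have inel: "y' $ (e, k, t, g) = y $ (e, k, t, g)" if "g \<in> ineligible M" for e k t g
    using other that eligible_not_ineligible by blast
  have x: "lane_flow M y' = lane_flow M y" by (rule lane_flow_eqI[OF agg other])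
  define L where "L y = (\<Sum>t\<in>UNIV. \<Sum>e\<in>edges M. \<Sum>k\<in>UNIV. \<Sum>g\<in>groups_on M e \<inter> eligible M.
       vot M t g * latency M e (lane_flow M y' e k t) * y $ (e, k, t, g))" for y :: "('e, 't, 'g) flow"
  \<comment> \<open>\<open>R\<close> is what eligible users pay. It counts as their cost with weight
    \<open>lamE\<close> and as revenue with weight \<open>lamR\<close>.\<close>
  define R where "R = (\<Sum>t\<in>UNIV. \<Sum>e\<in>edges M. \<Sum>g\<in>groups_on M e \<inter> eligible M.
       (1 - \<alpha> $ (e, t)) * \<tau> $ (e, t) * y' $ (e, 1, t, g))"
  define I where "I = (\<Sum>t\<in>UNIV. \<Sum>e\<in>edges M. \<Sum>k\<in>UNIV. \<Sum>g\<in>groups_on M e \<inter> ineligible M.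
       (vot M t g * latency M e (lane_flow M y e k t) + of_bool (k = 1) * \<tau> $ (e, t)) * y $ (e, k, t, g))"
  define T where "T = (\<Sum>t\<in>UNIV. \<Sum>e\<in>edges M. \<Sum>g\<in>groups_on M e \<inter> ineligible M.
       \<tau> $ (e, t) * y $ (e, 1, t, g))"
  have adm': "y' \<in> adm_flows M" using eq by (simp add: dbcp_equilibrium_def equilibrium_def)
  have "L y' \<le> L y" unfolding L_def using agg by (intro dbcp_latency_cost_le[OF eq y]) simp
  moreover have "0 \<le> R"
    unfolding R_def using \<tau> \<alpha> adm_flowD(1)[OF adm']
    by (intro sum_nonneg mult_nonneg_nonneg) (auto simp: tolls_def discounts_def)
  moreover have "(\<Sum>t\<in>UNIV. \<Sum>e\<in>edges M. \<Sum>k\<in>UNIV. \<Sum>g\<in>groups_on M e \<inter> eligible M.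
       (vot M t g * latency M e (lane_flow M y' e k t) + of_bool (k = 1) * (1 - \<alpha> $ (e, t)) * \<tau> $ (e, t))
         * y' $ (e, k, t, g)) = L y' + R"
    unfolding L_def R_def sum_2 by (simp add: distrib_right sum.distrib add_ac)
  moreover have "(\<Sum>t\<in>UNIV. \<Sum>e\<in>edges M. \<Sum>k\<in>UNIV. \<Sum>g\<in>groups_on M e \<inter> ineligible M.
       (vot M t g * latency M e (lane_flow M y' e k t) + of_bool (k = 1) * \<tau> $ (e, t)) * y' $ (e, k, t, g)) = I"
    unfolding I_def x by (intro sum.cong refl) (auto simp: inel)
  moreover have "(\<Sum>t\<in>UNIV. \<Sum>e\<in>edges M.
       (\<Sum>g\<in>groups_on M e \<inter> eligible M. (1 - \<alpha> $ (e, t)) * \<tau> $ (e, t) * y' $ (e, 1, t, g))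
       + (\<Sum>g\<in>groups_on M e \<inter> ineligible M. \<tau> $ (e, t) * y' $ (e, 1, t, g))) = R + T"
    unfolding R_def T_def sum.distrib[symmetric]
    by (intro sum.cong refl arg_cong2[where f = plus]) (auto simp: inel)
  ultimately have "dbcp_societal M lamE lamR lamI y' (lane_flow M y') \<tau> \<alpha>
      = lamE * (L y' + R) + lamI * I - lamR * (R + T)"
    by (simp only: dbcp_societal_def)
  moreover have "cbcp_societal M lamE lamR lamI y (lane_flow M y) \<tau> = lamE * L y - lamR * T + lamI * I"
    by (simp only: cbcp_societal_def L_def I_def T_def x)
  moreover have "lamE * L y' \<le> lamE * L y" "lamE * R \<le> lamR * R"
    using lam \<open>L y' \<le> L y\<close> \<open>0 \<le> R\<close> by (auto intro: mult_left_mono mult_right_mono)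
  ultimately show ?thesis by (simp add: algebra_simps)
qed

end

theorem theorem5p6:
  fixes M :: "('v, 'e::finite, 't::finite, 'g::finite) lane_model"
    and h :: "('e, 't, 'g) flow \<times> ('e, 't) edge_vec \<Rightarrow> real ^ 'c"
    and lamE lamR lamI :: real
  assumes "chain_network (network M)"
    and "valid_model M"
    and "0 \<le> lamE" and "0 \<le> lamR" and "0 \<le> lamI"
    and h_continuous: "continuous_on (adm_flows M \<times> edge_vecs M) h"
    and h_bounded: "bounded {z \<in> adm_flows M \<times> edge_vecs M. h z \<le> 0}"
    and h_aggregate: "\<And>\<tau> y y'. \<lbrakk>\<tau> \<in> tolls M; y \<in> adm_flows M; y' \<in> adm_flows M;
        \<forall>e\<in>edges M. \<forall>k t.
          (\<Sum>g\<in>groups_on M e \<inter> eligible M. y $ (e, k, t, g))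
            = (\<Sum>g\<in>groups_on M e \<inter> eligible M. y' $ (e, k, t, g)) \<and>
          (\<forall>g\<in>groups_on M e \<inter> ineligible M. y $ (e, k, t, g) = y' $ (e, k, t, g))\<rbrakk>
      \<Longrightarrow> h (y, \<tau>) = h (y', \<tau>)"
    and no_eligible_express: "\<And>\<tau> y e t g. \<lbrakk>\<tau> \<in> tolls M; dbcp_equilibrium M \<tau> 0 y; e \<in> edges M;
        0 < \<tau> $ (e, t); g \<in> groups_on M e \<inter> eligible M\<rbrakk> \<Longrightarrow> y $ (e, 1, t, g) = 0"
    and "lamE \<le> lamR"
  shows "dbcp_opt M h lamE lamR lamI \<le> cbcp_opt M h lamE lamR lamI"
  unfolding cbcp_opt_def
\<comment> \<open>It suffices to match each feasible CBCP point with a feasible DBCP point of no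
  larger cost, here at the same tolls.\<close>
proof (rule Inf_greatest, clarify)
  interpret chain_model M using assms(1,2) by unfold_locales
  fix y \<tau> B
  assume \<tau>: "\<tau> \<in> tolls M" and eq: "cbcp_equilibrium M \<tau> B y" and hy: "h (y, \<tau>) \<le> 0"
  have y: "y \<in> adm_flows M"
    using eq by (simp add: cbcp_equilibrium_def equilibrium_def cbcp_flows_def)
  have no_eligible: "y $ (e, 1, t, g) = 0"
    if "dbcp_equilibrium M \<tau> 0 y" "0 < \<tau> $ (e, t)" "g \<in> groups_on M e \<inter> eligible M" for y e t g
    using no_eligible_express[OF \<tau> that(1) _ that(2,3)] that(3) in_groups_on_imp[of g M e] by simp
  obtain y' \<alpha> where \<alpha>: "\<alpha> \<in> discounts M" and eq': "dbcp_equilibrium M \<tau> \<alpha> y'"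
    and other: "\<And>e k t g. g \<notin> eligible M \<Longrightarrow> y' $ (e, k, t, g) = y $ (e, k, t, g)"
    and agg: "\<And>e k t. (\<Sum>g\<in>groups_on M e \<inter> eligible M. y' $ (e, k, t, g))
       = (\<Sum>g\<in>groups_on M e \<inter> eligible M. y $ (e, k, t, g))"
    by (rule cbcp_equilibrium_to_dbcp[OF _ \<tau> eq]) (erule (2) no_eligible, rule that)
  have inel: "y' $ (e, k, t, g) = y $ (e, k, t, g)" if "g \<in> ineligible M" for e k t g
    using other that eligible_not_ineligible by blast
  have "y' \<in> adm_flows M" using eq' by (simp add: dbcp_equilibrium_def equilibrium_def)
  \<comment> \<open>Only eligible users were reshuffled and their aggregates kept, so the constraint
    still holds.\<close>
  then have "h (y', \<tau>) = h (y, \<tau>)"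
    using y \<tau> agg inel by (intro h_aggregate) auto
  then have "dbcp_opt M h lamE lamR lamI \<le> ereal (dbcp_societal M lamE lamR lamI y' (lane_flow M y') \<tau> \<alpha>)"
    unfolding dbcp_opt_def using \<tau> \<alpha> eq' hy
    by - (rule Inf_lower, rule CollectI, rule exI[of _ y'], rule exI[of _ "lane_flow M y'"],
        rule exI[of _ \<tau>], rule exI[of _ \<alpha>], simp)
  also have "\<dots> \<le> ereal (cbcp_societal M lamE lamR lamI y (lane_flow M y) \<tau>)"
    using dbcp_societal_le_cbcp_societal[OF \<open>0 \<le> lamE\<close> \<open>lamE \<le> lamR\<close> \<tau> \<alpha> eq' y other agg] by simp
  finally show "dbcp_opt M h lamE lamR lamI \<le> ereal (cbcp_societal M lamE lamR lamI y (lane_flow M y) \<tau>)" .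
qed

end
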